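(* Let $\lambda>0$, $q\in(0,1)$, $r>0$, and for each $n\in\mathbb{N}$ let $p_n=\min\{q,\lambda/n\}$ and let $N_{r,p_n}$ be a random variable having the negative binomial distribution with parameters $r$ and $p_n$. Let $X_1,X_2,\ldots$ be independent identically distributed real random variables with common distribution function $F(x)$, such that for each $n$ the random variable $N_{r,p_n}$ is independent of the sequence $X_1,X_2,\ldots$. Assume that $\mathrm{rext}(F)=\infty$ and that there exists a number $\gamma>0$ such that for every $x>0$ $$\lim_{y\to\infty}\frac{1-F(xy)}{1-F(y)}=x^{-\gamma}.$$ Then $$\lim_{n\to\infty}\sup_{x\ge 0}\left|\mathsf{P}\left(\frac{\max\{X_1,\ldots,X_{N_{r,p_n}}\}}{F^{-1}(1-\frac1n)}<x\right)-F(x;r,\lambda,\gamma)\right|=0,$$ where $$F(x;r,\lambda,\gamma)=\left(\frac{\lambda x^{\gamma}}{1+\lambda x^{\gamma}}\right)^r,\qquad x\ge 0.$$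
   Context: All random variables are defined on one probability space with probability $\mathsf{P}$. The distribution function of a random variable $X$ is $x\mapsto\mathsf{P}(X<x)$. A random variable $N_{r,p}$ has the negative binomial distribution with parameters $r>0$ and $p\in(0,1)$ if $$\mathsf{P}(N_{r,p}=k)=\frac{\Gamma(r+k)}{k!\,\Gamma(r)}\,p^r(1-p)^k,\qquad k=0,1,2,\ldots$$ For a distribution function $F$ and $a\in\mathbb{R}$, $\mathrm{rext}(F)=\sup\{x:F(x)<1\}$ and $F^{-1}(a)=\inf\{x:F(x)\ge a\}$. Since $\mathrm{rext}(F)=\infty$, $F^{-1}(1-\frac1n)$ is finite and positive for all sufficiently large $n$, and the limit concerns only such $n$. On the event $\{N_{r,p_n}=0\}$ the maximum is over the empty set; it may be assigned any fixed value, e.g. $0$ (the probability of this event is $p_n^r\to0$). *)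

theory Defs
  imports "HOL-Probability.Probability"
begin

text \<open>
  The distribution function is the left-continuous one, defined by the strict inequality;
  the library constant \<open>cdf\<close> uses the non-strict inequality instead.
\<close>
definition dist_fun :: "'a measure \<Rightarrow> ('a \<Rightarrow> real) \<Rightarrow> real \<Rightarrow> real" where
  "dist_fun M Y x = measure M {\<omega> \<in> space M. Y \<omega> < x}"

text \<open>
  The parameter \<open>r\<close> is an arbitrary positive real number, so the library's
  \<open>neg_binomial_pmf\<close>, whose first parameter is a natural number, does not apply.
\<close>
definition neg_binomial_rv :: "'a measure \<Rightarrow> ('a \<Rightarrow> nat) \<Rightarrow> real \<Rightarrow> real \<Rightarrow> bool" where
  "neg_binomial_rv M K r p \<longleftrightarrow>
     K \<in> measurable M (count_space UNIV) \<and>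
     (\<forall>k. measure M {\<omega> \<in> space M. K \<omega> = k} =
            Gamma (r + real k) / (fact k * Gamma r) * p powr r * (1 - p) ^ k)"

text \<open>
  The library's \<open>indep_var\<close> requires both random variables to take values in the same type.
  This is the same notion for two possibly different value types.
\<close>
definition indep_pair ::
  "'a measure \<Rightarrow> 'b measure \<Rightarrow> ('a \<Rightarrow> 'b) \<Rightarrow> 'c measure \<Rightarrow> ('a \<Rightarrow> 'c) \<Rightarrow> bool" where
  "indep_pair M S Y T Z \<longleftrightarrow>
     Y \<in> measurable M S \<and> Z \<in> measurable M T \<and>
     prob_space.indep_set M {Y -` A \<inter> space M | A. A \<in> sets S}
                            {Z -` B \<inter> space M | B. B \<in> sets T}"

lemma (in prob_space) indep_var_iff_indep_pair:
  "indep_var S Y T Z \<longleftrightarrow> indep_pair M S Y T Z"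
proof -
  have eq: "(\<lambda>i. {case_bool Y Z i -` A \<inter> space M | A. A \<in> sets (case_bool S T i)})
      = case_bool {Y -` A \<inter> space M | A. A \<in> sets S} {Z -` B \<inter> space M | B. B \<in> sets T}"
    by (rule ext) (simp split: bool.split)
  show ?thesis
    unfolding indep_var_def indep_vars_def2 indep_pair_def indep_set_def eq
    by (auto simp: UNIV_bool)
qed

definition rext :: "(real \<Rightarrow> real) \<Rightarrow> ereal" where
  "rext F = Sup (ereal ` {x. F x < 1})"

text \<open>
  As an infimum in the type of reals this is meaningful only when the set is nonempty and
  bounded below; for a distribution function this is the case whenever \<open>0 < a < 1\<close>.
\<close>
definition quantile :: "(real \<Rightarrow> real) \<Rightarrow> real \<Rightarrow> real" where
  "quantile F a = Inf {x. a \<le> F x}"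

text \<open>
  The maximum of \<open>X 1, \<dots>, X (K \<omega>)\<close>; the constant \<open>c\<close> is the value assigned to
  the maximum over the empty set.
\<close>
definition random_max :: "real \<Rightarrow> (nat \<Rightarrow> 'a \<Rightarrow> real) \<Rightarrow> ('a \<Rightarrow> nat) \<Rightarrow> 'a \<Rightarrow> real" where
  "random_max c X K \<omega> = (if K \<omega> = 0 then c else Max ((\<lambda>i. X i \<omega>) ` {1..K \<omega>}))"

definition limit_df :: "real \<Rightarrow> real \<Rightarrow> real \<Rightarrow> real \<Rightarrow> real" where
  "limit_df r l g x = ((l * x powr g) / (1 + l * x powr g)) powr r"

end

theory Submission
  imports Defs
begin

text \<open>
  Conditioning on the sample size shows that \<open>P(max < y)\<close> differs from the generating function
  \<open>(p / (1 - (1 - p) F(y))) powr r\<close> of the negative binomial law at \<open>F(y)\<close> only through the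
  empty sample, that is by at most \<open>p powr r\<close>. Regular variation of the tail gives
  \<open>n (1 - F(a\<^sub>n)) \<longlonglongrightarrow> 1\<close> for \<open>a\<^sub>n = F\<^sup>-\<^sup>1(1 - 1/n)\<close>, hence
  \<open>n (1 - F(x a\<^sub>n)) \<longlonglongrightarrow> x powr -\<gamma>\<close>, and so pointwise convergence for \<open>x > 0\<close>. The limit is
  monotone and attains every value in \<open>(0, 1)\<close>, which makes the convergence uniform as in
  Polya's theorem.
\<close>

section \<open>Generating series of the negative binomial law\<close>

text \<open>Binomial series for \<open>(1 + - z) powr (- r)\<close>: the sign in
  \<open>(- r) gchoose k\<close> cancels that of \<open>(- z) ^ k\<close>, and the remaining
  Pochhammer symbol is a quotient of Gamma values.\<close>

lemma neg_binomial_series_sums: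
  fixes r z :: real
  assumes "r > 0" "\<bar>z\<bar> < 1"
  shows "(\<lambda>k. Gamma (r + real k) / (fact k * Gamma r) * z ^ k) sums (1 - z) powr (- r)"
proof -
  have r: "r \<notin> \<int>\<^sub>\<le>\<^sub>0"
    using assms(1) by (auto elim!: nonpos_Ints_cases)
  have "(\<lambda>k. ((- r) gchoose k) * (- z) ^ k) sums (1 + - z) powr (- r)"
    by (rule gen_binomial_real) (use assms in auto)
  moreover have "((- r) gchoose k) * (- z) ^ k = Gamma (r + real k) / (fact k * Gamma r) * z ^ k" for k
  proof -
    have "((- r) gchoose k) * (- z) ^ k = ((- 1) ^ k * (- 1) ^ k) * (pochhammer r k / fact k * z ^ k)"
      by (simp add: gbinomial_pochhammer power_minus[of z k] algebra_simps)
    also have "((- 1) ^ k * (- 1) ^ k :: real) = 1"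
      by (simp flip: power_mult_distrib)
    finally show ?thesis
      using pochhammer_Gamma[OF r, of k] by (simp add: field_simps)
  qed
  ultimately show ?thesis by simp
qed

section \<open>From pointwise to uniform convergence of monotone functions\<close>

text \<open>Polya's argument: convergence is simultaneous at finitely many points where
  \<open>G\<close> takes the levels \<open>i / m\<close>, and monotonicity controls
  \<open>H n\<close> between them. That \<open>G\<close> attains all values in (0, 1) takes the
  place of continuity. The set \<open>T\<close> may omit points of \<open>S\<close>, such as the
  endpoint 0 in the application.\<close>

lemma uniform_limit_of_mono_pointwise:
  fixes H :: "nat \<Rightarrow> real \<Rightarrow> real" and G :: "real \<Rightarrow> real"
  assumes mono_H: "\<forall>\<^sub>F n in sequentially. mono_on S (H n)"
    and H01: "\<And>n x. x \<in> S \<Longrightarrow> H n x \<in> {0..1}"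
    and mono_G: "mono_on S G"
    and G01: "\<And>x. x \<in> S \<Longrightarrow> G x \<in> {0..1}"
    and "T \<subseteq> S" and surj: "{0<..<1} \<subseteq> G ` T"
    and lim: "\<And>x. x \<in> T \<Longrightarrow> (\<lambda>n. H n x) \<longlonglongrightarrow> G x"
  shows "uniform_limit S H G sequentially"
  unfolding uniform_limit_iff
proof (intro allI impI)
  fix e :: real assume "e > 0"
  \<comment> \<open>The error budget is at most two grid steps, each below \<open>e / 3\<close>, and
    one pointwise error below \<open>e / 3\<close>.\<close>
  then obtain m :: nat where m: "m > 0" "inverse (real m) < e / 3"
    using ex_inverse_of_nat_less[of "e / 3"] by auto
  have "\<forall>i\<in>{1..<m}. \<exists>x\<in>T. G x = real i / real m"
  proof
    fix i assume "i \<in> {1..<m}"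
    then have "real i / real m \<in> {0<..<1}" by (auto simp: field_simps)
    then show "\<exists>x\<in>T. G x = real i / real m" using surj by (metis imageE subsetD)
  qed
  then obtain t where t: "\<And>i. i \<in> {1..<m} \<Longrightarrow> t i \<in> T \<and> G (t i) = real i / real m"
    by metis
  have "\<forall>\<^sub>F n in sequentially. \<forall>i\<in>{1..<m}. dist (H n (t i)) (G (t i)) < e / 3"
  proof (intro eventually_ball_finite ballI)
    fix i assume "i \<in> {1..<m}"
    then have "(\<lambda>n. H n (t i)) \<longlonglongrightarrow> G (t i)" using t lim by blast
    then show "\<forall>\<^sub>F n in sequentially. dist (H n (t i)) (G (t i)) < e / 3"
      using \<open>e > 0\<close> by (intro tendstoD) auto
  qed simp
  with mono_H show "\<forall>\<^sub>F n in sequentially. \<forall>x\<in>S. dist (H n x) (G x) < e"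
  proof eventually_elim
    case (elim n)
    show ?case
    proof
      fix x assume x: "x \<in> S"
      define i where "i = nat \<lfloor>real m * G x\<rfloor>"
      have i: "real i \<le> real m * G x" "real m * G x < real i + 1"
        using G01[OF x] unfolding i_def by auto
      have Gi: "real i / real m \<le> G x" "G x < (real i + 1) / real m"
        using i m(1) by (auto simp: field_simps)
      have near: "\<bar>H n (t j) - real j / real m\<bar> < e / 3" if "j \<in> {1..<m}" for j
        using elim(2) t[OF that] that by (metis dist_real_def)
      have below: "u \<le> v" if "u \<in> S" "v \<in> S" "G u < G v" for u v
        using mono_onD[OF mono_G, of v u] that by linarith
      \<comment> \<open>The comparison point has level \<open>i - 1\<close>: \<open>G x\<close> may
        equal \<open>i / m\<close>, and only a strict inequality between values of \<open>G\<close>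
        orders the arguments. For \<open>i < 2\<close>, \<open>G x\<close> is below two grid steps
        and \<open>H n x \<ge> 0\<close> is enough.\<close>
      have "H n x > G x - e"
      proof (cases "i \<ge> 2")
        case True
        have "real i \<le> real m" using i(1) G01[OF x] m(1)
          by (smt (verit) atLeastAtMost_iff mult_left_le of_nat_0_le_iff)
        with True have j: "i - 1 \<in> {1..<m}" by auto
        have "G (t (i - 1)) < G x"
          using t[OF j] Gi(1) True m(1) by (smt (verit) divide_strict_right_mono of_nat_less_iff
              diff_less of_nat_0_less_iff zero_less_one pos2 order_less_le_trans)
        then have "t (i - 1) \<le> x" using below t[OF j] x \<open>T \<subseteq> S\<close> by blast
        then have "H n (t (i - 1)) \<le> H n x"
          using mono_onD[OF elim(1)] t[OF j] x \<open>T \<subseteq> S\<close> by blast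
        moreover have "real (i - 1) / real m = (real i + 1) / real m - 2 * inverse (real m)"
          using True m(1) by (simp add: divide_simps)
        ultimately show ?thesis using near[OF j] Gi m(2) by linarith
      next
        case False
        then have "(real i + 1) / real m \<le> 2 / real m" by (intro divide_right_mono) auto
        then have "G x < 2 * inverse (real m)" using Gi(2) by (simp add: field_simps)
        then show ?thesis using H01[OF x, of n] m(2) \<open>e > 0\<close> by auto
      qed
      \<comment> \<open>Level \<open>i + 1\<close> is strictly above \<open>G x\<close>, so one grid
        step is lost. If that level is not below 1, then \<open>G x\<close> is within one grid step
        of 1 and \<open>H n x \<le> 1\<close> is enough.\<close>
      moreover have "H n x < G x + e"
      proof (cases "i + 1 < m")
        case True
        then have j: "i + 1 \<in> {1..<m}" by auto
        have "G x < G (t (i + 1))" using t[OF j] Gi(2) by (simp add: add.commute)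
        then have "x \<le> t (i + 1)" using below t[OF j] x \<open>T \<subseteq> S\<close> by blast
        then have "H n x \<le> H n (t (i + 1))"
          using mono_onD[OF elim(1)] t[OF j] x \<open>T \<subseteq> S\<close> by blast
        moreover have "real (i + 1) / real m = real i / real m + inverse (real m)"
          by (simp add: add_divide_distrib inverse_eq_divide)
        ultimately show ?thesis using near[OF j] Gi(1) m(2) \<open>e > 0\<close> by linarith
      next
        case False
        then have "real m - 1 \<le> real i" by linarith
        then have "(real m - 1) / real m \<le> real i / real m" by (intro divide_right_mono) auto
        moreover have "(real m - 1) / real m = 1 - inverse (real m)"
          using m(1) by (simp add: field_simps)
        ultimately have "1 - inverse (real m) \<le> G x" using Gi(1) by linarith
        then show ?thesis using H01[OF x, of n] m(2) \<open>e > 0\<close> by auto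
      qed
      ultimately show "dist (H n x) (G x) < e" by (simp add: dist_real_def abs_less_iff)
    qed
  qed
qed

lemma uniform_limit_imp_SUP_tendsto_0:
  fixes H :: "nat \<Rightarrow> 'b \<Rightarrow> real"
  assumes "uniform_limit S H G sequentially" "S \<noteq> {}"
  shows "(\<lambda>n. SUP x\<in>S. \<bar>H n x - G x\<bar>) \<longlonglongrightarrow> 0"
proof (rule tendstoI)
  fix e :: real assume "e > 0"
  \<comment> \<open>A supremum preserves only non-strict bounds, hence the smaller
    \<open>e / 2\<close>.\<close>
  then have "\<forall>\<^sub>F n in sequentially. \<forall>x\<in>S. dist (H n x) (G x) < e / 2"
    using assms(1) unfolding uniform_limit_iff by (meson half_gt_zero)
  then show "\<forall>\<^sub>F n in sequentially. dist (SUP x\<in>S. \<bar>H n x - G x\<bar>) 0 < e"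
  proof eventually_elim
    case (elim n)
    then have le: "\<bar>H n x - G x\<bar> \<le> e / 2" if "x \<in> S" for x
      using that by (force simp: dist_real_def)
    \<comment> \<open>A point of \<open>S\<close> is needed to see that the supremum is
      nonnegative.\<close>
    obtain s where s: "s \<in> S" using assms(2) by auto
    have "(SUP x\<in>S. \<bar>H n x - G x\<bar>) \<le> e / 2"
      using le assms(2) by (intro cSUP_least) auto
    moreover have "\<bar>H n s - G s\<bar> \<le> (SUP x\<in>S. \<bar>H n x - G x\<bar>)"
      using s le by (intro cSUP_upper bdd_aboveI2[where M = "e / 2"]) auto
    ultimately show ?case using \<open>e > 0\<close> by (simp add: dist_real_def)
  qed
qed

section \<open>Distribution functions\<close>

lemma (in prob_space) mono_dist_fun:
  assumes "random_variable borel Y"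
  shows "mono (dist_fun M Y)"
  unfolding dist_fun_def using assms
  by (intro monoI finite_measure_mono) auto

lemma (in prob_space) dist_fun_tendsto_1:
  assumes Y: "random_variable borel Y"
  shows "(\<lambda>n. dist_fun M Y (real n)) \<longlonglongrightarrow> 1"
proof -
  have "(\<lambda>n. prob {\<omega> \<in> space M. Y \<omega> < real n}) \<longlonglongrightarrow> prob (\<Union>n. {\<omega> \<in> space M. Y \<omega> < real n})"
    using Y by (intro finite_Lim_measure_incseq) (auto simp: incseq_def)
  also have "(\<Union>n. {\<omega> \<in> space M. Y \<omega> < real n}) = space M"
    using reals_Archimedean2 by auto
  finally show ?thesis by (simp add: dist_fun_def prob_space)
qed

text \<open>Left continuity: because of the strict inequality, the event \<open>Y < a\<close> is the
  increasing union of the events \<open>Y < a - 1 / (n + 1)\<close>.\<close>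

lemma (in prob_space) dist_fun_le_of_less:
  assumes Y: "random_variable borel Y" and le: "\<And>x. x < a \<Longrightarrow> dist_fun M Y x \<le> b"
  shows "dist_fun M Y a \<le> b"
proof -
  let ?A = "\<lambda>n. {\<omega> \<in> space M. Y \<omega> < a - inverse (real (Suc n))}"
  have "(\<lambda>n. prob (?A n)) \<longlonglongrightarrow> prob (\<Union>n. ?A n)"
  proof (rule finite_Lim_measure_incseq)
    show "range ?A \<subseteq> events" using Y by auto
    show "incseq ?A"
    proof (rule incseq_SucI, rule subsetI)
      fix n \<omega> assume "\<omega> \<in> ?A n"
      moreover have "inverse (real (Suc (Suc n))) \<le> inverse (real (Suc n))"
        by (rule le_imp_inverse_le) auto
      then have "a - inverse (real (Suc n)) \<le> a - inverse (real (Suc (Suc n)))" by linarith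
      ultimately show "\<omega> \<in> ?A (Suc n)" by (blast intro: less_le_trans)
    qed
  qed
  also have "(\<Union>n. ?A n) = {\<omega> \<in> space M. Y \<omega> < a}"
  proof safe
    fix \<omega> n assume "Y \<omega> < a - inverse (real (Suc n))"
    moreover have "inverse (real (Suc n)) > 0" by simp
    ultimately show "Y \<omega> < a" by linarith
  next
    fix \<omega> assume \<omega>: "\<omega> \<in> space M" "Y \<omega> < a"
    then obtain n where "inverse (real (Suc n)) < a - Y \<omega>"
      using reals_Archimedean[of "a - Y \<omega>"] by auto
    then have "Y \<omega> < a - inverse (real (Suc n))" by linarith
    then show "\<omega> \<in> (\<Union>n. ?A n)" using \<omega> by auto
  qed
  finally have "(\<lambda>n. dist_fun M Y (a - inverse (real (Suc n)))) \<longlonglongrightarrow> dist_fun M Y a"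
    by (simp add: dist_fun_def)
  then show ?thesis by (rule LIMSEQ_le_const2) (auto intro!: le)
qed

section \<open>The maximum of a random number of variables\<close>

lemma (in prob_space) prob_all_less:
  fixes X :: "nat \<Rightarrow> 'a \<Rightarrow> real"
  assumes "indep_vars (\<lambda>_. borel) X {1..}" and "\<And>i. i \<ge> 1 \<Longrightarrow> dist_fun M (X i) = F"
  shows "prob {\<omega> \<in> space M. \<forall>i\<in>{1..k}. X i \<omega> < y} = F y ^ k"
\<comment> \<open>The product formula for independent variables is applied to a nonempty index set;
  for \<open>k = 0\<close> both sides are 1.\<close>
proof (cases "k = 0")
  case True
  then show ?thesis by (simp add: prob_space)
next
  case False
  have "prob (\<Inter>i\<in>{1..k}. X i -` {..<y} \<inter> space M) = (\<Prod>i\<in>{1..k}. prob (X i -` {..<y} \<inter> space M))"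
    using assms(1) False by (intro indep_varsD[where I = "{1..}"]) auto
  also have "(\<Inter>i\<in>{1..k}. X i -` {..<y} \<inter> space M) = {\<omega> \<in> space M. \<forall>i\<in>{1..k}. X i \<omega> < y}"
    using False by auto
  also have "(\<Prod>i\<in>{1..k}. prob (X i -` {..<y} \<inter> space M)) = (\<Prod>i\<in>{1..k}. F y)"
  proof (rule prod.cong)
    fix i assume "i \<in> {1..k}"
    then have "dist_fun M (X i) y = F y" using assms(2) by simp
    then show "prob (X i -` {..<y} \<inter> space M) = F y"
      unfolding dist_fun_def by (simp add: vimage_def Int_def conj_commute)
  qed simp
  finally show ?thesis by simp
qed

text \<open>Independence of \<open>K\<close> from the whole sequence is applied to the cylinder of
  sequences with coordinates 1 to \<open>k\<close> below \<open>y\<close>, a measurable set since it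
  constrains finitely many coordinates.\<close>

lemma (in prob_space) prob_eq_and_all_less:
  fixes X :: "nat \<Rightarrow> 'a \<Rightarrow> real" and K :: "'a \<Rightarrow> nat"
  assumes indep: "indep_pair M (count_space UNIV) K
                    (PiM {1..} (\<lambda>_. borel)) (\<lambda>\<omega>. \<lambda>i\<in>{1..}. X i \<omega>)"
  shows "prob {\<omega> \<in> space M. K \<omega> = k \<and> (\<forall>i\<in>{1..k}. X i \<omega> < y)} =
           prob {\<omega> \<in> space M. K \<omega> = k} * prob {\<omega> \<in> space M. \<forall>i\<in>{1..k}. X i \<omega> < y}"
proof -
  let ?Z = "\<lambda>\<omega>. \<lambda>i\<in>{1::nat..}. X i \<omega>" and ?P = "PiM {1::nat..} (\<lambda>_. borel :: real measure)"
  let ?B = "{f \<in> space ?P. \<forall>i\<in>{1..k}. f i < y}"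
  have Z: "?Z \<in> measurable M ?P" using indep by (simp add: indep_pair_def)
  have B: "?B \<in> sets ?P" by measurable
  have "?Z -` ?B \<inter> space M = {\<omega> \<in> space M. \<forall>i\<in>{1..k}. X i \<omega> < y}"
    using measurable_space[OF Z] by auto
  moreover have "K -` {k} \<inter> space M = {\<omega> \<in> space M. K \<omega> = k}" by auto
  moreover have "prob ((K -` {k} \<inter> space M) \<inter> (?Z -` ?B \<inter> space M)) =
      prob (K -` {k} \<inter> space M) * prob (?Z -` ?B \<inter> space M)"
  proof (rule indep_setD)
    show "indep_set {K -` A \<inter> space M | A. A \<in> sets (count_space UNIV)}
        {?Z -` B \<inter> space M | B. B \<in> sets ?P}"
      using indep by (simp add: indep_pair_def)
    show "K -` {k} \<inter> space M \<in> {K -` A \<inter> space M | A. A \<in> sets (count_space UNIV)}"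
      by auto
    show "?Z -` ?B \<inter> space M \<in> {?Z -` B \<inter> space M | B. B \<in> sets ?P}"
      using B by (intro CollectI exI[of _ ?B] conjI refl)
  qed
  moreover have "{\<omega> \<in> space M. K \<omega> = k} \<inter> {\<omega> \<in> space M. \<forall>i\<in>{1..k}. X i \<omega> < y} =
      {\<omega> \<in> space M. K \<omega> = k \<and> (\<forall>i\<in>{1..k}. X i \<omega> < y)}" by auto
  ultimately show ?thesis by simp
qed

lemma random_max_less_iff:
  "random_max c X K \<omega> < y \<longleftrightarrow>
     (K \<omega> = 0 \<longrightarrow> c < y) \<and> (\<forall>i\<in>{1..K \<omega>}. X i \<omega> < y)"
proof (cases "K \<omega> = 0")
  case False
  then have "finite ((\<lambda>i. X i \<omega>) ` {1..K \<omega>})" "(\<lambda>i. X i \<omega>) ` {1..K \<omega>} \<noteq> {}" by simp_all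
  from Max_less_iff[OF this] False show ?thesis by (simp add: random_max_def)
qed (simp add: random_max_def)

text \<open>Splitting by the countably many values of \<open>K\<close> leaves only finite
  conjunctions of measurable conditions.\<close>

lemma (in prob_space) random_variable_random_max:
  fixes X :: "nat \<Rightarrow> 'a \<Rightarrow> real"
  assumes K [measurable]: "K \<in> measurable M (count_space UNIV)"
    and X: "\<And>i. i \<ge> 1 \<Longrightarrow> random_variable borel (X i)"
  shows "random_variable borel (random_max c X K)"
proof (rule borel_measurableI_less)
  fix y
  have [measurable]: "{\<omega> \<in> space M. K \<omega> = k} \<in> events" for k
    by measurable
  have "{\<omega> \<in> space M. random_max c X K \<omega> < y} =
      (\<Union>k. {\<omega> \<in> space M. K \<omega> = k} \<inter>
        {\<omega> \<in> space M. (k = 0 \<longrightarrow> c < y) \<and> (\<forall>i\<in>{1..k}. X i \<omega> < y)})"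
    by (auto simp: random_max_less_iff)
  also have "\<dots> \<in> events"
  proof (intro sets.countable_UN'' sets.Int)
    fix k
    show "{\<omega> \<in> space M. (k = 0 \<longrightarrow> c < y) \<and> (\<forall>i\<in>{1..k}. X i \<omega> < y)} \<in> events"
      using X by (intro sets.sets_Collect_conj sets.sets_Collect_const sets.sets_Collect_finite_All) auto
  qed auto
  finally show "{\<omega> \<in> space M. random_max c X K \<omega> < y} \<in> events" .
qed

text \<open>Conditioning on \<open>K = k\<close> yields the terms of the generating function at
  \<open>F y\<close> for every \<open>k \<ge> 1\<close>. At \<open>k = 0\<close> the event is empty
  or all of \<open>K = 0\<close>, depending on \<open>c < y\<close>, so the error is at most
  \<open>P(K = 0) = p powr r\<close>, whatever \<open>c\<close> is.\<close>

lemma (in prob_space) dist_fun_random_max_near_pgf: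
  fixes X :: "nat \<Rightarrow> 'a \<Rightarrow> real"
  assumes r: "r > 0" and p: "0 < p" "p < 1"
    and K: "neg_binomial_rv M K r p"
    and X: "indep_vars (\<lambda>_. borel) X {1..}" and F: "\<And>i. i \<ge> 1 \<Longrightarrow> dist_fun M (X i) = F"
    and indep: "indep_pair M (count_space UNIV) K
                  (PiM {1..} (\<lambda>_. borel)) (\<lambda>\<omega>. \<lambda>i\<in>{1..}. X i \<omega>)"
  shows "\<bar>dist_fun M (random_max c X K) y - (p / (1 - (1 - p) * F y)) powr r\<bar> \<le> p powr r"
proof -
  have Km [measurable]: "K \<in> measurable M (count_space UNIV)"
    using K by (simp add: neg_binomial_rv_def)
  define w where "w k = prob {\<omega> \<in> space M. K \<omega> = k}" for k
  have w: "w k = Gamma (r + real k) / (fact k * Gamma r) * p powr r * (1 - p) ^ k" for k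
    using K by (simp add: neg_binomial_rv_def w_def)
  have Xm: "random_variable borel (X i)" if "i \<ge> 1" for i
    using X that by (auto simp: indep_vars_def)
  have F01: "0 \<le> F y" "F y \<le> 1"
    unfolding F[OF order_refl, symmetric] dist_fun_def by simp_all
  define A where "A k = {\<omega> \<in> space M. K \<omega> = k \<and> random_max c X K \<omega> < y}" for k
  have "(\<lambda>k. prob (A k)) sums prob (\<Union>k. A k)"
  proof (rule finite_measure_UNION)
    have "{\<omega> \<in> space M. random_max c X K \<omega> < y} \<in> events"
      using random_variable_random_max[OF Km Xm] by simp
    then show "range A \<subseteq> events"
      unfolding A_def by (auto intro!: sets.sets_Collect_conj)
  qed (auto simp: A_def disjoint_family_on_def)
  also have "(\<Union>k. A k) = {\<omega> \<in> space M. random_max c X K \<omega> < y}"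
    by (auto simp: A_def)
  finally have sA: "(\<lambda>k. prob (A k)) sums dist_fun M (random_max c X K) y"
    by (simp add: dist_fun_def)
  \<comment> \<open>The factor \<open>1 - p < 1\<close> keeps the argument inside the disc of
    convergence even when \<open>F y = 1\<close>.\<close>
  have z: "0 \<le> (1 - p) * F y" "(1 - p) * F y < 1"
    using F01 p by (auto intro: le_less_trans[OF mult_left_le])
  have "(\<lambda>k. p powr r * (Gamma (r + real k) / (fact k * Gamma r) * ((1 - p) * F y) ^ k))
      sums (p powr r * (1 - (1 - p) * F y) powr (- r))"
    by (intro sums_mult neg_binomial_series_sums) (use r z in auto)
  moreover have "p powr r * (1 - (1 - p) * F y) powr (- r) = (p / (1 - (1 - p) * F y)) powr r"
    using p z by (simp add: powr_divide powr_minus field_simps)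
  ultimately have sB: "(\<lambda>k. w k * F y ^ k) sums ((p / (1 - (1 - p) * F y)) powr r)"
    by (simp only: w power_mult_distrib mult_ac times_divide_eq_left times_divide_eq_right)
  have Ak: "prob (A k) = w k * F y ^ k" if "k \<noteq> 0" for k
  proof -
    have "A k = {\<omega> \<in> space M. K \<omega> = k \<and> (\<forall>i\<in>{1..k}. X i \<omega> < y)}"
      using that by (auto simp: A_def random_max_less_iff)
    then show ?thesis
      using prob_eq_and_all_less[OF indep, of k y] prob_all_less[OF X F, of k y] by (simp add: w_def)
  qed
  \<comment> \<open>The two series differ in the term \<open>k = 0\<close> alone, so the difference
    of their sums is that single term.\<close>
  have "(\<lambda>k. prob (A k) - w k * F y ^ k) sums (\<Sum>k\<in>{0}. prob (A k) - w k * F y ^ k)"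
    by (rule sums_finite) (auto simp: Ak)
  from sums_unique2[OF this sums_diff[OF sA sB]]
  have "dist_fun M (random_max c X K) y - (p / (1 - (1 - p) * F y)) powr r = prob (A 0) - w 0"
    by simp
  moreover have "prob (A 0) \<le> w 0"
    unfolding w_def A_def by (intro finite_measure_mono) auto
  moreover have "w 0 = p powr r"
    using Gamma_real_pos[OF r] by (simp add: w)
  ultimately show ?thesis using measure_nonneg[of M "A 0"] by linarith
qed

section \<open>The limit distribution function\<close>

text \<open>In this form the limit of the generating functions appears. At \<open>x = 0\<close> it
  would fail: \<open>0 powr (- g)\<close> is 0 by convention, which makes the right-hand side 1
  instead of 0.\<close>

lemma limit_df_eq:
  assumes "l > 0" "x > 0"
  shows "limit_df r l g x = (1 / (1 + x powr (- g) / l)) powr r"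
proof -
  have "0 < l * x powr g" using assms by simp
  then have "(l * x powr g) / (1 + l * x powr g) = 1 / (1 + x powr (- g) / l)"
    using assms by (simp add: powr_minus field_simps)
  then show ?thesis by (simp add: limit_df_def)
qed

lemma limit_df_mem_Icc:
  assumes "l > 0" "r > 0"
  shows "limit_df r l g x \<in> {0..1}"
proof -
  have "0 \<le> l * x powr g" using assms by simp
  moreover from this have "l * x powr g / (1 + l * x powr g) \<le> 1"
    by (intro divide_le_eq_1_pos[THEN iffD2]) linarith+
  ultimately show ?thesis using assms
    unfolding limit_df_def by (auto intro!: powr_le1)
qed

lemma mono_on_limit_df:
  assumes "l > 0" "r > 0" "g > 0"
  shows "mono_on {0..} (limit_df r l g)"
proof (rule mono_onI)
  fix x y :: real assume xy: "x \<in> {0..}" "y \<in> {0..}" "x \<le> y"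
  have "0 \<le> l * x powr g" using assms by simp
  moreover have "l * x powr g \<le> l * y powr g"
    using xy assms by (intro mult_left_mono powr_mono2) auto
  moreover have "s / (1 + s) \<le> t / (1 + t)" if "0 \<le> s" "s \<le> t" for s t :: real
    using that by (intro frac_le_eq[THEN iffD2]) (simp_all add: divide_le_0_iff algebra_simps)
  ultimately show "limit_df r l g x \<le> limit_df r l g y"
    using assms unfolding limit_df_def by (intro powr_mono2) auto
qed

text \<open>Explicit inversion: after taking the root \<open>u\<close> of order \<open>r\<close>,
  the equation \<open>s / (1 + s) = u\<close> has the solution \<open>s = u / (1 - u)\<close>, and
  \<open>s = l * x powr g\<close> is solved for \<open>x\<close>.\<close>

lemma limit_df_surj:
  assumes "l > 0" "r > 0" "g > 0"
  shows "{0<..<1} \<subseteq> limit_df r l g ` {0<..}"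
proof
  fix v :: real assume v: "v \<in> {0<..<1}"
  define u where "u = v powr (1 / r)"
  have u: "0 < u" "u < 1"
    using v assms powr_less_mono2[of "1 / r" v 1] by (auto simp: u_def)
  define x where "x = (u / (l * (1 - u))) powr (1 / g)"
  have "x powr g = u / (l * (1 - u))"
    using assms u by (simp add: x_def powr_powr)
  then have eq: "l * x powr g = u / (1 - u)"
    using assms by simp
  have "(l * x powr g) / (1 + l * x powr g) = u"
    unfolding eq using u by (simp add: field_simps)
  then have "limit_df r l g x = v"
    using v assms by (simp add: limit_df_def u_def powr_powr)
  moreover have "x > 0" using assms u by (simp add: x_def)
  ultimately show "v \<in> limit_df r l g ` {0<..}" by force
qed

section \<open>Quantiles and the regularly varying tail\<close>

context
  fixes M :: "'a measure" and Y :: "'a \<Rightarrow> real" and F :: "real \<Rightarrow> real"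
  assumes M: "prob_space M" and Y: "Y \<in> borel_measurable M" and F: "dist_fun M Y = F"
begin

interpretation prob_space M by (rule M)

lemma mono_df: "mono F"
  using mono_dist_fun[OF Y] F by simp

lemma quantile_set_nonempty:
  assumes "a < 1"
  shows "{x. a \<le> F x} \<noteq> {}"
proof -
  have "\<forall>\<^sub>F n in sequentially. F (real n) > a"
    using order_tendstoD(1)[OF dist_fun_tendsto_1[OF Y] assms] F by simp
  then show ?thesis by (auto simp: eventually_sequentially intro: less_imp_le)
qed

lemma quantile_ge:
  assumes "a < 1" "F y < a"
  shows "y \<le> quantile F a"
  unfolding quantile_def
proof (rule cInf_greatest[OF quantile_set_nonempty[OF assms(1)]])
  fix x assume "x \<in> {x. a \<le> F x}"
  then show "y \<le> x" using assms(2) monoD[OF mono_df, of x y] by force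
qed

lemma quantile_bdd_below:
  assumes "F y < a"
  shows "bdd_below {x. a \<le> F x}"
proof (rule bdd_belowI)
  fix x assume "x \<in> {x. a \<le> F x}"
  then show "y \<le> x" using assms monoD[OF mono_df, of x y] by force
qed

text \<open>All points left of the infimum have value below \<open>a\<close>, and left continuity
  carries the bound to the infimum itself. The point \<open>y\<close> ensures that the set is
  bounded below, so that \<open>Inf\<close> is a genuine infimum.\<close>

lemma df_quantile_le:
  assumes "F y < a"
  shows "F (quantile F a) \<le> a"
proof -
  have "F x \<le> a" if "x < quantile F a" for x
    using that cInf_lower[OF _ quantile_bdd_below[OF assms], of x] unfolding quantile_def by force
  then show ?thesis using dist_fun_le_of_less[OF Y, of "quantile F a" a] F by simp
qed

text \<open>Strictness matters: for a left-continuous \<open>F\<close> with a jump at the quantile,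
  the value there may still be below \<open>a\<close>.\<close>

lemma df_gt_quantile:
  assumes "a < 1" "quantile F a < x"
  shows "a \<le> F x"
proof -
  obtain z where "a \<le> F z" "z < x"
    using cInf_lessD[OF quantile_set_nonempty[OF assms(1)], of x] assms(2)
    unfolding quantile_def by auto
  then show ?thesis using monoD[OF mono_df, of z x] by auto
qed

context
  assumes rext: "rext F = \<infinity>"
begin

lemma df_less_1: "F y < 1"
proof (rule ccontr)
  assume "\<not> F y < 1"
  then have "x \<le> y" if "F x < 1" for x
    using that monoD[OF mono_df, of y x] by linarith
  then have "rext F \<le> ereal y"
    unfolding rext_def by (auto intro!: Sup_least)
  with rext show False by simp
qed

text \<open>Supplies the point of value below the level \<open>1 - 1 / n\<close> that bounds the
  quantile from below.\<close>

lemma eventually_df_less: "\<forall>\<^sub>F n in sequentially. F y < 1 - 1 / real n"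
proof -
  have "(\<lambda>n. 1 - 1 / real n) \<longlonglongrightarrow> 1 - 0"
    by (intro tendsto_intros lim_const_over_n)
  then show ?thesis using order_tendstoD(1)[of _ "1 - 0" sequentially "F y"] df_less_1[of y] by simp
qed

lemma quantile_at_top: "filterlim (\<lambda>n. quantile F (1 - 1 / real n)) at_top sequentially"
  unfolding filterlim_at_top
proof
  fix y
  show "\<forall>\<^sub>F n in sequentially. y \<le> quantile F (1 - 1 / real n)"
    using eventually_df_less[of y] eventually_gt_at_top[of 0]
    by eventually_elim (rule quantile_ge, auto)
qed

text \<open>It suffices that \<open>n * (1 - F (a n))\<close> tends to 1, since regular variation
  along \<open>a n\<close> gives the factor \<open>x powr (- g)\<close>. Jumps of \<open>F\<close>
  may prevent equality with 1, so the value is enclosed: from below by left continuity at the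
  quantile, from above by comparison with points \<open>u * a n\<close>,
  \<open>u > 1\<close>.\<close>

lemma tail_quantile_tendsto:
  assumes RV: "\<And>x. x > 0 \<Longrightarrow> ((\<lambda>y. (1 - F (x * y)) / (1 - F y)) \<longlongrightarrow> x powr (- g)) at_top"
    and "x > 0"
  shows "(\<lambda>n. real n * (1 - F (x * quantile F (1 - 1 / real n)))) \<longlonglongrightarrow> x powr (- g)"
proof -
  define a where "a n = quantile F (1 - 1 / real n)" for n
  have a: "filterlim a at_top sequentially"
    unfolding a_def by (rule quantile_at_top)
  have RVa: "(\<lambda>n. (1 - F (x * a n)) / (1 - F (a n))) \<longlonglongrightarrow> x powr (- g)" if "x > 0" for x
    using filterlim_compose[OF RV[OF that] a] by simp
  have pos: "0 < 1 - F z" for z using df_less_1[of z] by simp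
  have lower: "\<forall>\<^sub>F n in sequentially. 1 \<le> real n * (1 - F (a n))"
    using eventually_df_less[of 0] eventually_gt_at_top[of 0]
  proof eventually_elim
    case (elim n)
    then have "F (a n) \<le> 1 - 1 / real n" unfolding a_def by (intro df_quantile_le[of 0])
    then show ?case using elim(2) by (simp add: field_simps)
  qed
  \<comment> \<open>Beyond the quantile, \<open>n * (1 - F (u * a n)) \<le> 1\<close>. Moving back
    to \<open>a n\<close> costs a factor tending to \<open>u powr g\<close>, which is below
    \<open>b\<close> once \<open>u\<close> is close enough to 1.\<close>
  have upper: "\<forall>\<^sub>F n in sequentially. real n * (1 - F (a n)) < b" if "b > 1" for b
  proof -
    have "((\<lambda>u::real. u powr (- g)) \<longlongrightarrow> 1 powr (- g)) (at_right 1)"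
      by (intro tendsto_intros) auto
    then have "\<forall>\<^sub>F u in at_right 1. 1 / b < u powr (- g)"
      using that by (intro order_tendstoD) auto
    moreover have "\<forall>\<^sub>F u::real in at_right 1. u > 1" by (rule eventually_at_right_less)
    ultimately have "\<forall>\<^sub>F u::real in at_right 1. u > 1 \<and> 1 / b < u powr (- g)"
      by eventually_elim auto
    then obtain u :: real where u: "u > 1" "1 / b < u powr (- g)"
      using eventually_happens'[of "at_right (1::real)"] by auto
    have "\<forall>\<^sub>F n in sequentially. 1 / b < (1 - F (u * a n)) / (1 - F (a n))"
      using order_tendstoD(1)[OF RVa u(2)] u(1) by simp
    moreover have "\<forall>\<^sub>F n in sequentially. a n > 0"
      using a by (simp add: filterlim_at_top_dense)
    ultimately show ?thesis using eventually_gt_at_top[of 0]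
    proof eventually_elim
      case (elim n)
      have "a n < u * a n" using u(1) elim(2) by simp
      then have "1 - 1 / real n \<le> F (u * a n)"
        using elim(3) unfolding a_def by (intro df_gt_quantile) auto
      then have "real n * (1 - F (u * a n)) \<le> 1" using elim(3) by (simp add: field_simps)
      moreover have "1 - F (a n) < b * (1 - F (u * a n))"
        using elim(1) that pos[of "a n"] by (simp add: field_simps)
      then have "real n * (1 - F (a n)) < b * (real n * (1 - F (u * a n)))"
        using elim(3) by (simp add: mult.left_commute[of b])
      ultimately show ?case using that
        by (smt (verit, best) mult_left_le)
    qed
  qed
  have "(\<lambda>n. real n * (1 - F (a n))) \<longlonglongrightarrow> 1"
  proof (rule order_tendstoI)
    fix b :: real assume "b < 1"
    then show "\<forall>\<^sub>F n in sequentially. b < real n * (1 - F (a n))"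
      using lower by (auto elim: eventually_mono)
  qed (rule upper)
  \<comment> \<open>The tail at \<open>a n\<close> cancels in the product because it is never
    0.\<close>
  from tendsto_mult[OF this RVa[OF \<open>x > 0\<close>]] show ?thesis
    unfolding a_def[symmetric] by (simp add: less_imp_neq[OF df_less_1])
qed

end

end

section \<open>Convergence of the normalised random maximum\<close>

lemma eventually_neg_binomial_parameter_eq:
  fixes l q :: real
  assumes "l > 0" "q > 0"
  shows "\<forall>\<^sub>F n in sequentially. min q (l / real n) = l / real n"
proof -
  have "\<forall>\<^sub>F n in sequentially. l / real n < q"
    using order_tendstoD(2)[OF lim_const_over_n[of l] assms(2)] .
  then show ?thesis by eventually_elim auto
qed

theorem theorem2:
  fixes M :: "'a measure"
    and X :: "nat \<Rightarrow> 'a \<Rightarrow> real"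
    and N :: "nat \<Rightarrow> 'a \<Rightarrow> nat"
    and F :: "real \<Rightarrow> real"
    and l q r \<gamma> c :: real
  assumes "prob_space M"
    and "l > 0" and "0 < q" and "q < 1" and "r > 0"
    and "\<And>n. n \<ge> 1 \<Longrightarrow> neg_binomial_rv M (N n) r (min q (l / real n))"
    and "prob_space.indep_vars M (\<lambda>_. borel) X {1..}"
    and "\<And>i. i \<ge> 1 \<Longrightarrow> dist_fun M (X i) = F"
    and "\<And>n. n \<ge> 1 \<Longrightarrow>
           indep_pair M
             (count_space UNIV) (N n)
             (PiM {1..} (\<lambda>_. borel)) (\<lambda>\<omega>. \<lambda>i\<in>{1..}. X i \<omega>)"
    and "rext F = \<infinity>"
    and "\<gamma> > 0"
    and "\<And>x. x > 0 \<Longrightarrow> ((\<lambda>y. (1 - F (x * y)) / (1 - F y)) \<longlongrightarrow> x powr (- \<gamma>)) at_top"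
  shows "(\<lambda>n. SUP x\<in>{0..}.
            \<bar>dist_fun M (\<lambda>\<omega>. random_max c X (N n) \<omega> / quantile F (1 - 1 / real n)) x
              - limit_df r l \<gamma> x\<bar>) \<longlonglongrightarrow> 0"
proof -
  interpret prob_space M by (rule assms(1))
  define a where "a n = quantile F (1 - 1 / real n)" for n
  define p where "p n = min q (l / real n)" for n
  define H where "H n x = dist_fun M (\<lambda>\<omega>. random_max c X (N n) \<omega> / a n) x" for n x
  have Xm: "random_variable borel (X i)" if "i \<ge> 1" for i
    using assms(7) that by (auto simp: indep_vars_def)
  have X1: "dist_fun M (X 1) = F" using assms(8) by simp
  note df = assms(1) Xm[OF order_refl] X1 assms(10)
  have p: "0 < p n" "p n < 1" if "n \<ge> 1" for n
    using that assms(2-4) by (auto simp: p_def)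
  have p_eq: "\<forall>\<^sub>F n in sequentially. p n = l / real n"
    unfolding p_def by (rule eventually_neg_binomial_parameter_eq) fact+
  then have p_lim: "p \<longlonglongrightarrow> 0"
    using lim_const_over_n[of l] by (simp add: tendsto_cong)
  have a_pos: "\<forall>\<^sub>F n in sequentially. a n > 0"
    using quantile_at_top[OF df] unfolding a_def by (simp add: filterlim_at_top_dense)
  have max_rv: "random_variable borel (random_max c X (N n))" if "n \<ge> 1" for n
    using assms(6)[OF that] Xm by (intro random_variable_random_max) (auto simp: neg_binomial_rv_def)
  have H_mono: "\<forall>\<^sub>F n in sequentially. mono_on {0..} (H n)"
    using eventually_ge_at_top[of 1]
  proof eventually_elim
    case (elim n)
    have "mono (H n)" unfolding H_def using max_rv[OF elim] by (intro mono_dist_fun) simp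
    then show ?case by (simp add: mono_imp_mono_on)
  qed
  have lim: "(\<lambda>n. H n x) \<longlonglongrightarrow> limit_df r l \<gamma> x" if "x \<in> {0<..}" for x
  proof -
    from that have x: "x > 0" by simp
    \<comment> \<open>The generating function at \<open>F (x * a n)\<close> after substituting
      \<open>l / n\<close> for the parameter in the denominator, so that each ingredient has a known
      limit.\<close>
    define J where "J n = (1 / (1 + (1 - p n) * (real n * (1 - F (x * a n))) / l)) powr r" for n
    have tail: "(\<lambda>n. real n * (1 - F (x * a n))) \<longlonglongrightarrow> x powr (- \<gamma>)"
      unfolding a_def by (rule tail_quantile_tendsto[OF df assms(12) x])
    have pos: "0 < 1 + (1 - 0) * x powr (- \<gamma>) / l"
      using assms(2) by (intro add_pos_nonneg) auto
    have "J \<longlonglongrightarrow> (1 / (1 + (1 - 0) * x powr (- \<gamma>) / l)) powr r"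
      unfolding J_def by (intro tendsto_intros p_lim tail) (use pos assms(2) in auto)
    then have J: "J \<longlonglongrightarrow> limit_df r l \<gamma> x"
      using limit_df_eq[OF assms(2) x] by simp
    have "\<forall>\<^sub>F n in sequentially. norm (H n x - J n) \<le> p n powr r"
      using p_eq a_pos eventually_ge_at_top[of 1]
    proof eventually_elim
      case (elim n)
      \<comment> \<open>Positivity of the normalisation \<open>a n\<close> allows it to be moved
        across the inequality.\<close>
      have "H n x = dist_fun M (random_max c X (N n)) (x * a n)"
        using elim(2) by (simp add: H_def dist_fun_def pos_divide_less_eq)
      moreover have "p n / (1 - (1 - p n) * F (x * a n)) =
          1 / (1 + (1 - p n) * (real n * (1 - F (x * a n))) / l)"
      proof -
        let ?s = "F (x * a n)"
        have "1 - (1 - p n) * ?s = p n * (1 + (1 - p n) * (1 - ?s) / p n)"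
          using p[OF elim(3)] by (simp add: field_simps)
        \<comment> \<open>Only the dividing \<open>p n\<close> is replaced by \<open>l / n\<close>;
          the factor \<open>1 - p n\<close> stays and tends to 1.\<close>
        also have "(1 - p n) * (1 - ?s) / p n = (1 - p n) * (real n * (1 - ?s)) / l"
          using elim(3) assms(2) by (subst (2) elim(1)) simp
        finally show ?thesis using p[OF elim(3)] by simp
      qed
      ultimately show ?case
        using dist_fun_random_max_near_pgf[OF assms(5) p[OF elim(3)] assms(6)[OF elim(3), folded p_def]
          assms(7,8) assms(9)[OF elim(3)], of c "x * a n"]
        by (simp add: J_def)
    qed
    moreover have "(\<lambda>n. p n powr r) \<longlonglongrightarrow> 0"
    proof (rule tendsto_zero_powrI[OF p_lim tendsto_const])
      show "\<forall>\<^sub>F n in sequentially. 0 \<le> p n"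
        using eventually_ge_at_top[of 1] by eventually_elim (rule less_imp_le[OF p(1)])
    qed (use assms(5) in auto)
    ultimately have "(\<lambda>n. H n x - J n) \<longlonglongrightarrow> 0"
      by (rule Lim_null_comparison)
    from tendsto_add[OF this J] show ?thesis by simp
  qed
  \<comment> \<open>The values of the limit on the open half-line already fill (0, 1), so pointwise
    convergence there gives uniformity on the closed one.\<close>
  have "uniform_limit {0..} H (limit_df r l \<gamma>) sequentially"
    by (rule uniform_limit_of_mono_pointwise[where T = "{0<..}"])
      (use H_mono lim mono_on_limit_df[OF assms(2,5,11)] limit_df_surj[OF assms(2,5,11)]
        limit_df_mem_Icc[OF assms(2,5)] in \<open>auto simp: H_def dist_fun_def\<close>)
  then show ?thesis
    using uniform_limit_imp_SUP_tendsto_0[of H "{0..}" "limit_df r l \<gamma>"] by (simp add: H_def a_def)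
qed

end
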